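(* Let $\mathbb{K}$ be an algebraically closed field of characteristic zero. Let $p,q\in\mathbb{K}[x]$ be monic polynomials of relatively prime positive degrees $m>n$, let $A=\langle p,q\rangle$ be the subalgebra of $\mathbb{K}[x]$ they generate, and let $\alpha\in\mathbb{K}$. The following are equivalent: (i) $\alpha$ belongs to the spectrum of $A$, i.e. either $f'(\alpha)=0$ for every $f\in A$, or there exists $\beta\neq\alpha$ in $\mathbb{K}$ such that $f(\alpha)=f(\beta)$ for every $f\in A$. (ii) Either $p'(\alpha)=q'(\alpha)=0$, or there exists $\beta\neq\alpha$ in $\mathbb{K}$ such that $p(\alpha)=p(\beta)$ and $q(\alpha)=q(\beta)$. (iii) $\alpha$ is a root of the characteristic polynomial $\chi_{p,q}(x)$.
   Context: Subalgebras contain all constants. For polynomials $p,q$ set $P(x,y)=\frac{p(x)-p(y)}{x-y}$ and $Q(x,y)=\frac{q(x)-q(y)}{x-y}$, which are polynomials in $x,y$. The characteristic polynomial is the resultant $\chi_{p,q}(x)=\operatorname{Res}_y(P(x,y),Q(x,y))$ of $P$ and $Q$ considered as polynomials in $y$ with coefficients in $\mathbb{K}[x]$. *)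

theory Defs
  imports "HOL-Computational_Algebra.Computational_Algebra" "Subresultants.Resultant_Prelim"
begin

text \<open>
  Unital subalgebras of the polynomial ring: since all constants belong to the set, closure
  under scalar multiplication and negation is a consequence of closure under products.
\<close>

definition is_poly_subalgebra :: "'a::field poly set \<Rightarrow> bool" where
  "is_poly_subalgebra A \<longleftrightarrow>
     (\<forall>c. [:c:] \<in> A) \<and> (\<forall>f\<in>A. \<forall>g\<in>A. f + g \<in> A) \<and> (\<forall>f\<in>A. \<forall>g\<in>A. f * g \<in> A)"

definition generated_subalgebra :: "'a::field poly set \<Rightarrow> 'a poly set" where
  "generated_subalgebra S = is_poly_subalgebra hull S"

definition subalgebra_spectrum :: "'a::field poly set \<Rightarrow> 'a set" where
  "subalgebra_spectrum A =
     {\<alpha>. (\<forall>f\<in>A. poly (pderiv f) \<alpha> = 0) \<or> (\<exists>\<beta>. \<beta> \<noteq> \<alpha> \<and> (\<forall>f\<in>A. poly f \<alpha> = poly f \<beta>))}"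

text \<open>
  A bivariate polynomial in \<open>x\<close> and \<open>y\<close> is an element of \<open>'a poly poly\<close>: a polynomial in
  \<open>y\<close> whose coefficients are polynomials in \<open>x\<close>. So \<open>[:p:]\<close> is $p(x)$,
  \<open>map_poly (\<lambda>c. [:c:]) p\<close> is $p(y)$ and \<open>[:[:0, 1:], -1:]\<close> is $x - y$.
\<close>

definition divided_difference :: "'a::field poly \<Rightarrow> 'a poly poly" where
  "divided_difference p = ([:p:] - map_poly (\<lambda>c. [:c:]) p) div [:[:0, 1:], -1:]"

definition characteristic_poly :: "'a::field poly \<Rightarrow> 'a poly \<Rightarrow> 'a poly" where
  "characteristic_poly p q = resultant (divided_difference p) (divided_difference q)"

lemma is_poly_subalgebra_generated: "is_poly_subalgebra (generated_subalgebra S)"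
  unfolding generated_subalgebra_def
  by (rule hull_in) (auto simp: is_poly_subalgebra_def)

text \<open>The division in \<open>divided_difference\<close> is exact.\<close>

lemma poly_map_poly_const_X: "poly (map_poly (\<lambda>c. [:c:]) p) [:0, 1:] = (p :: 'a::field poly)"
  by (induction p) (auto simp: map_poly_pCons)

lemma poly_map_poly_const: "poly (map_poly (\<lambda>c. [:c:]) p) [:b:] = [:poly p (b::'a::field):]"
  by (induction p) (auto simp: map_poly_pCons)

lemma divided_difference_mult:
  "divided_difference p * [:[:0, 1:], -1:] = [:p:] - map_poly (\<lambda>c. [:c:]) (p :: 'a::field poly)"
proof -
  have "[:-[:0, 1:], 1:] dvd [:p:] - map_poly (\<lambda>c. [:c:]) p"
    by (subst poly_eq_0_iff_dvd[symmetric]) (simp add: poly_map_poly_const_X)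
  moreover have "[:[:0, 1:], -1:] = - [:-[:0, 1:], 1 :: 'a poly:]"
    by simp
  ultimately have "[:[:0, 1:], -1:] dvd [:p:] - map_poly (\<lambda>c. [:c:]) p"
    by (metis minus_dvd_iff)
  then show ?thesis
    unfolding divided_difference_def by (rule dvd_div_mult_self)
qed

lemma poly_divided_difference:
  "poly (poly (divided_difference p) [:b:]) a * (a - b) = poly p a - poly p (b::'a::field)"
  using arg_cong[OF divided_difference_mult[of p], of "\<lambda>P. poly (poly P [:b:]) a"]
  by (simp add: poly_map_poly_const algebra_simps)

end

theory Submission
  imports Defs
begin

text \<open>
  The equivalence of (i) and (ii) only says that the two conditions defining the spectrum may be
  tested on the generators. For fixed $\alpha$ and $\beta$, the polynomials with
  $f'(\alpha) = 0$ form a subalgebra, by the Leibniz rule, and so do those with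
  $f(\alpha) = f(\beta)$; either subalgebra therefore contains the generated one as soon as it
  contains the generators.

  For the equivalence of (ii) and (iii), substitute $x = \alpha$ in the divided differences.
  From $P(\alpha,y)(\alpha - y) = p(\alpha) - p(y)$ one reads off that a number
  $\beta \neq \alpha$ is a root of $P(\alpha,y)$ exactly when $p(\alpha) = p(\beta)$, while
  differentiating this identity at $y = \alpha$ gives $P(\alpha,\alpha) = p'(\alpha)$. So (ii)
  states that $P(\alpha,y)$ and $Q(\alpha,y)$ have a common root, the case of the derivatives
  being the common root $\alpha$ itself. The leading coefficients of $P$ and $Q$ in $y$ are
  nonzero constants, hence the substitution preserves the degrees in $y$ and commutes with the
  resultant: $\chi_{p,q}(\alpha)$ is the resultant of $P(\alpha,y)$ and $Q(\alpha,y)$. Over an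
  algebraically closed field this vanishes exactly when the two have a common root
  (\<open>resultant_eq_0_iff_common_root\<close>).

  That last fact is linear algebra on the Sylvester matrix. The entries of each row are the
  coefficients of $y^k f$ or $y^k g$. A common root $b$ thus makes the vector of powers of $b$ a
  kernel vector. Conversely a nonzero vector in the left kernel is a relation $a f + c g = 0$ with $\deg a < \deg g$ and $\deg c < \deg f$, not both
  zero. If $f$ and $g$ had no common root, splitting off the roots of $f$ one at a time would
  show $f \mid c$, and the degrees would force $c = 0$ and then $a = 0$.
\<close>

unbundle no fps_syntax

section \<open>The spectrum of a generated subalgebra is seen on the generators\<close>

lemma generator_in_generated_subalgebra: "f \<in> S \<Longrightarrow> f \<in> generated_subalgebra S"
  unfolding generated_subalgebra_def by (rule hull_inc)

lemma generated_subalgebra_subset: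
  "S \<subseteq> A \<Longrightarrow> is_poly_subalgebra A \<Longrightarrow> generated_subalgebra S \<subseteq> A"
  unfolding generated_subalgebra_def by (rule hull_minimal)

lemma is_poly_subalgebra_equal_values: "is_poly_subalgebra {f. poly f a = poly f b}"
  by (auto simp: is_poly_subalgebra_def)

lemma is_poly_subalgebra_critical: "is_poly_subalgebra {f. poly (pderiv f) a = 0}"
  by (auto simp: is_poly_subalgebra_def pderiv_add pderiv_mult pderiv_pCons)

text \<open>
  Any condition that is stable under the algebra operations may be tested on generators; both
  clauses in the definition of the spectrum are of this kind.
\<close>

lemma generated_subalgebra_Ball_iff:
  assumes "is_poly_subalgebra {f. P f}"
  shows "(\<forall>f\<in>generated_subalgebra S. P f) \<longleftrightarrow> (\<forall>f\<in>S. P f)"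
  using generated_subalgebra_subset[OF _ assms, of S] generator_in_generated_subalgebra[of _ S]
  by blast

lemma mem_subalgebra_spectrum_generated_iff:
  "a \<in> subalgebra_spectrum (generated_subalgebra S) \<longleftrightarrow>
     (\<forall>f\<in>S. poly (pderiv f) a = 0) \<or> (\<exists>b. b \<noteq> a \<and> (\<forall>f\<in>S. poly f a = poly f b))"
  unfolding subalgebra_spectrum_def mem_Collect_eq
    generated_subalgebra_Ball_iff[OF is_poly_subalgebra_critical]
    generated_subalgebra_Ball_iff[OF is_poly_subalgebra_equal_values] ..

section \<open>Resultants over algebraically closed fields\<close>

text \<open>
  The Sylvester matrix lists coefficients from the top degree down, so vectors are turned into
  polynomials in reversed order. The offset \<open>l\<close> selects a block of consecutive
  entries, as the two blocks of a row vector are multiplied with different polynomials.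
\<close>

lemma coeff_sum_monom_reversed:
  fixes v :: "nat \<Rightarrow> 'a::comm_monoid_add"
  shows "coeff (\<Sum>i\<in>{l..<l+d}. monom (v i) (l + d - 1 - i)) k = (if k < d then v (l + d - 1 - k) else 0)"
proof -
  have "coeff (\<Sum>i\<in>{l..<l+d}. monom (v i) (l + d - 1 - i)) k
      = (\<Sum>i\<in>{l..<l+d}. if i = l + d - 1 - k \<and> k < d then v i else 0)"
    unfolding coeff_sum by (rule sum.cong) auto
  also have "\<dots> = (if k < d then v (l + d - 1 - k) else 0)"
    by (cases "k < d") auto
  finally show ?thesis .
qed

text \<open>
  This encodes the Sylvester matrix as polynomial identities, so that kernel vectors on either
  side can be read as evaluations or as relations between \<open>f\<close> and \<open>g\<close>.
\<close>

lemma sylvester_mat_row_poly: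
  fixes f g :: "'a::comm_semiring_1 poly"
  defines "m \<equiv> degree f" and "n \<equiv> degree g"
  assumes i: "i < m + n"
  shows "(\<Sum>j<m+n. monom (sylvester_mat f g $$ (i,j)) (m + n - 1 - j))
       = (if i < n then monom 1 (n - 1 - i) * f else monom 1 (m + n - 1 - i) * g)"
proof (rule poly_eqI)
  fix k
  show "coeff (\<Sum>j<m+n. monom (sylvester_mat f g $$ (i,j)) (m + n - 1 - j)) k
       = coeff (if i < n then monom 1 (n - 1 - i) * f else monom 1 (m + n - 1 - i) * g) k"
  proof (cases "k < m + n")
    case True
    then show ?thesis
      using i coeff_sum_monom_reversed[of "\<lambda>j. sylvester_mat f g $$ (i,j)" 0 "m + n" k]
      by (auto simp: lessThan_atLeast0 sylvester_index_mat2 m_def n_def coeff_monom_mult)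
  next
    case False
    then show ?thesis
      using i coeff_sum_monom_reversed[of "\<lambda>j. sylvester_mat f g $$ (i,j)" 0 "m + n" k]
      by (auto simp: lessThan_atLeast0 coeff_monom_mult m_def n_def intro!: coeff_eq_0)
  qed
qed

text \<open>
  Evaluating the rows at the common root exhibits the vector of its powers as a kernel vector.
  The condition on \<open>f\<close> excludes two zero polynomials, whose Sylvester matrix is
  empty and has determinant 1.
\<close>

lemma resultant_eq_0_if_common_root:
  fixes f g :: "'a::field poly"
  assumes "f \<noteq> 0" and f: "poly f b = 0" and g: "poly g b = 0"
  shows "resultant f g = 0"
proof -
  define N where "N = degree f + degree g"
  define w where "w = vec N (\<lambda>j. b ^ (N - 1 - j))"
  have "degree f > 0"
    using assms(1) f by (auto elim!: degree_eq_zeroE intro!: gr0I)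
  then have N: "N > 0"
    by (simp add: N_def)
  have "sylvester_mat f g *\<^sub>v w = 0\<^sub>v N"
  proof (rule eq_vecI)
    fix i assume "i < dim_vec (0\<^sub>v N :: 'a vec)"
    then have i: "i < N" by simp
    have "(sylvester_mat f g *\<^sub>v w) $ i
        = poly (\<Sum>j<N. monom (sylvester_mat f g $$ (i,j)) (N - 1 - j)) b"
      using i by (simp add: w_def N_def scalar_prod_def poly_sum poly_monom lessThan_atLeast0)
    also have "\<dots> = 0"
      using i f g unfolding N_def by (subst sylvester_mat_row_poly) auto
    finally show "(sylvester_mat f g *\<^sub>v w) $ i = 0\<^sub>v N $ i"
      using i by simp
  qed (simp add: N_def)
  (* The last entry of w is the zeroth power of b, so w is nonzero even for b = 0. *)
  moreover have "w $ (N - 1) \<noteq> 0\<^sub>v N $ (N - 1)"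
    using N by (simp add: w_def)
  then have "w \<noteq> 0\<^sub>v N" by metis
  moreover have "w \<in> carrier_vec N"
    by (simp add: w_def)
  ultimately show ?thesis
    unfolding resultant_def
    using det_0_iff_vec_prod_zero_field[of "sylvester_mat f g" N] sylvester_carrier_mat[of f g]
    by (auto simp: N_def)
qed

text \<open>
  A root of \<open>f\<close> is not a root of \<open>g\<close>, hence it is one of
  \<open>b\<close>; cancelling the common linear factor of \<open>f\<close> and
  \<open>b\<close> leaves a relation of the same shape with \<open>f\<close> of smaller degree.
\<close>

lemma dvd_cofactor_if_no_common_root:
  fixes a b f g :: "'a::alg_closed_field poly"
  assumes "f \<noteq> 0" and "a * f + b * g = 0" and "\<And>x. poly f x = 0 \<Longrightarrow> poly g x \<noteq> 0"
  shows "f dvd b"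
  using assms
proof (induction "degree f" arbitrary: f b)
  case 0
  then show ?case
    by (metis is_unit_iff_degree dvd_trans one_dvd)
next
  case (Suc d)
  then obtain x where x: "poly f x = 0"
    using alg_closed_imp_poly_has_root[of f] by auto
  have "poly (a * f + b * g) x = 0"
    using Suc.prems(2) by simp
  then have "poly b x = 0"
    using x Suc.prems(3)[OF x] by simp
  then obtain b' where b': "b = [:-x, 1:] * b'"
    by (auto simp: poly_eq_0_iff_dvd)
  from x obtain f' where f': "f = [:-x, 1:] * f'"
    by (auto simp: poly_eq_0_iff_dvd)
  have "f' \<noteq> 0"
    using Suc.prems(1) f' by auto
  moreover have "d = degree f'"
    using Suc.hyps(2) \<open>f' \<noteq> 0\<close> unfolding f' by (subst (asm) degree_mult_eq) auto
  moreover have "[:-x, 1:] * (a * f' + b' * g) = 0"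
    using Suc.prems(2) unfolding b' f' by (simp only: algebra_simps)
  then have "a * f' + b' * g = 0"
    by (simp only: mult_eq_0_iff) auto
  moreover have "poly g y \<noteq> 0" if "poly f' y = 0" for y
    using that Suc.prems(3)[of y] by (simp add: f')
  ultimately have "f' dvd b'"
    using Suc.hyps(1)[of f' b'] by blast
  then show ?case
    unfolding b' f' by (rule mult_dvd_mono[OF dvd_refl])
qed

text \<open>
  A left kernel vector of the Sylvester matrix is a relation between \<open>f\<close> and
  \<open>g\<close> whose cofactors are too small in degree to come from a multiple of
  \<open>(g, - f)\<close>.
\<close>

lemma common_root_if_resultant_eq_0:
  fixes f g :: "'a::alg_closed_field poly"
  assumes "f \<noteq> 0" and "resultant f g = 0"
  shows "\<exists>x. poly f x = 0 \<and> poly g x = 0"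
proof (rule ccontr)
  assume no_root: "\<not> ?thesis"
  define m n where "m = degree f" and "n = degree g"
  have S: "sylvester_mat f g \<in> carrier_mat (m + n) (m + n)"
    by (simp add: m_def n_def sylvester_carrier_mat)
  then have "det (transpose_mat (sylvester_mat f g)) = 0"
    using assms(2) by (simp add: det_transpose resultant_def)
  then obtain v where v: "v \<in> carrier_vec (m + n)" "v \<noteq> 0\<^sub>v (m + n)"
    "transpose_mat (sylvester_mat f g) *\<^sub>v v = 0\<^sub>v (m + n)"
    using det_0_iff_vec_prod_zero_field[of "transpose_mat (sylvester_mat f g)" "m + n"] S by auto
  have col: "(\<Sum>i<m+n. v $ i * sylvester_mat f g $$ (i,j)) = 0" if j: "j < m + n" for j
  proof -
    have "(transpose_mat (sylvester_mat f g) *\<^sub>v v) $ j = 0"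
      using v(3) j by simp
    then show ?thesis
      using j carrier_vecD[OF v(1)]
      by (simp add: m_def n_def scalar_prod_def lessThan_atLeast0 mult.commute)
  qed
  (* The two blocks of v are the coefficients of the cofactors of f and g. The redundant zeros
     match the offset form of coeff_sum_monom_reversed. *)
  define a where "a = (\<Sum>i\<in>{0..<0+n}. monom (v $ i) (0 + n - 1 - i))"
  define b where "b = (\<Sum>i\<in>{n..<n+m}. monom (v $ i) (n + m - 1 - i))"
  have "a * f + b * g
      = (\<Sum>i<m+n. Polynomial.smult (v $ i)
           (if i < n then monom 1 (n - 1 - i) * f else monom 1 (m + n - 1 - i) * g))"
  proof -
    have "{..<m+n} = {0..<n} \<union> {n..<n+m}" by auto
    then show ?thesis
      by (simp add: a_def b_def sum_distrib_right sum.union_disjoint add.commute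
          smult_monom flip: mult_smult_left)
  qed
  also have "\<dots> = (\<Sum>i<m+n. Polynomial.smult (v $ i)
      (\<Sum>j<m+n. monom (sylvester_mat f g $$ (i,j)) (m + n - 1 - j)))"
    unfolding m_def n_def by (rule sum.cong) (simp_all only: lessThan_iff sylvester_mat_row_poly)
  also have "\<dots> = (\<Sum>j<m+n. monom (\<Sum>i<m+n. v $ i * sylvester_mat f g $$ (i,j)) (m + n - 1 - j))"
    unfolding smult_sum2 smult_monom monom_sum by (rule sum.swap)
  also have "\<dots> = 0"
    by (simp add: col)
  finally have comb: "a * f + b * g = 0" .
  have coeff_a: "coeff a k = (if k < n then v $ (n - 1 - k) else 0)" for k
    unfolding a_def by (subst coeff_sum_monom_reversed) simp
  have coeff_b: "coeff b k = (if k < m then v $ (n + m - 1 - k) else 0)" for k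
    unfolding b_def by (rule coeff_sum_monom_reversed)
  have "f dvd b"
    using dvd_cofactor_if_no_common_root[OF assms(1) comb] no_root by blast
  (* Stated for coefficients because degree b < degree f fails when f is constant,
     where b is an empty sum. *)
  moreover have "coeff b k = 0" if "k \<ge> degree f" for k
    using that by (simp add: coeff_b m_def)
  ultimately have "b = 0"
    by (metis dvd_imp_degree_le leading_coeff_0_iff)
  then have "a = 0"
    using comb assms(1) by simp
  have "v $ i = 0" if "i < m + n" for i
  proof (cases "i < n")
    case True
    then show ?thesis using coeff_a[of "n - 1 - i"] \<open>a = 0\<close> by simp
  next
    case False
    then have "n + m - 1 - i < m" and "n + m - 1 - (n + m - 1 - i) = i"
      using that by auto
    then show ?thesis using coeff_b[of "n + m - 1 - i"] \<open>b = 0\<close> by simp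
  qed
  then have "v = 0\<^sub>v (m + n)"
    using v(1) by (intro eq_vecI) auto
  with v(2) show False ..
qed

lemma resultant_eq_0_iff_common_root:
  fixes f g :: "'a::alg_closed_field poly"
  assumes "f \<noteq> 0"
  shows "resultant f g = 0 \<longleftrightarrow> (\<exists>x. poly f x = 0 \<and> poly g x = 0)"
  using common_root_if_resultant_eq_0[OF assms, of g] resultant_eq_0_if_common_root[OF assms]
  by metis

section \<open>Specialising the divided difference\<close>

abbreviation divided_difference_at :: "'a::field \<Rightarrow> 'a poly \<Rightarrow> 'a poly" where
  "divided_difference_at a p \<equiv> map_poly (\<lambda>c. poly c a) (divided_difference p)"

lemma divided_difference_at_mult:
  "divided_difference_at a p * [:a, -1:] = [:poly p a:] - p"
proof -
  interpret ev: map_poly_comm_ring_hom "\<lambda>c::'a poly. poly c a" ..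
  have "divided_difference_at a p * map_poly (\<lambda>c. poly c a) [:[:0, 1:], -1:]
      = map_poly (\<lambda>c. poly c a) [:p:] - map_poly (\<lambda>c. poly c a) (map_poly (\<lambda>c. [:c:]) p)"
    using arg_cong[OF divided_difference_mult[of p], of "map_poly (\<lambda>c. poly c a)"]
    by (simp only: ev.hom_mult ev.hom_minus)
  moreover have "map_poly (\<lambda>c. poly c a) (map_poly (\<lambda>c. [:c:]) p) = p"
    by (simp add: map_poly_map_poly o_def)
  ultimately show ?thesis
    by (cases "p = 0") (simp_all add: map_poly_pCons)
qed

text \<open>
  On the diagonal the divided difference is the derivative, so a critical point is the limiting
  case of two points with equal values.
\<close>

lemma poly_divided_difference_at_eq_0_iff:
  "poly (divided_difference_at a p) b = 0 \<longleftrightarrow>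
     (if b = a then poly (pderiv p) a = 0 else poly p a = poly p b)"
proof (cases "b = a")
  case True
  have "poly (pderiv (divided_difference_at a p * [:a, -1:])) a
      = poly (pderiv ([:poly p a:] - p)) a"
    by (simp only: divided_difference_at_mult)
  then show ?thesis
    using True by (simp add: pderiv_mult pderiv_diff pderiv_pCons del: mult_pCons_right)
next
  case False
  have "poly (divided_difference_at a p) b * (a - b) = poly p a - poly p b"
    using arg_cong[OF divided_difference_at_mult[of a p], of "\<lambda>f. poly f b"] by (simp add: algebra_simps)
  then show ?thesis
    using False by auto
qed

lemma degree_const_minus:
  fixes r :: "'a::ab_group_add poly"
  assumes "degree r > 0"
  shows "degree ([:c:] - r) = degree r"
  using assms by (metis degree_add_eq_right degree_minus degree_pCons_0 diff_conv_add_uminus)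

text \<open>
  The generic and the specialised divided difference have the same degree in $y$; this is what
  allows the resultant to be specialised.
\<close>

lemma degree_divided_difference:
  assumes "degree p > 0"
  shows "degree (divided_difference p) = degree p - 1"
proof -
  have deg: "degree (map_poly (\<lambda>c. [:c:]) p) = degree p"
    by (rule degree_map_poly) simp
  have rhs: "degree (divided_difference p * [:[:0, 1:], -1:]) = degree p"
    using assms by (simp only: divided_difference_mult degree_const_minus deg)
  then have "divided_difference p \<noteq> 0"
    using assms by auto
  then show ?thesis
    using rhs by (subst (asm) degree_mult_eq) auto
qed

lemma degree_divided_difference_at:
  assumes "degree p > 0"
  shows "divided_difference_at a p \<noteq> 0"
    and "degree (divided_difference_at a p) = degree p - 1"
proof -
  have rhs: "degree (divided_difference_at a p * [:a, -1:]) = degree p"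
    using assms by (simp only: divided_difference_at_mult degree_const_minus)
  then show "divided_difference_at a p \<noteq> 0"
    using assms by auto
  then show "degree (divided_difference_at a p) = degree p - 1"
    using rhs by (subst (asm) degree_mult_eq) auto
qed

lemma poly_characteristic_poly:
  assumes "degree p > 0" and "degree q > 0"
  shows "poly (characteristic_poly p q) a
       = resultant (divided_difference_at a p) (divided_difference_at a q)"
  unfolding characteristic_poly_def
  by (rule poly_hom.resultant_map_poly[symmetric])
     (simp_all add: assms degree_divided_difference degree_divided_difference_at)

theorem theorem19:
  fixes p q :: "'a::{alg_closed_field, field_char_0} poly" and \<alpha> :: 'a
  assumes "lead_coeff p = 1" and "lead_coeff q = 1"
    and "degree q > 0" and "degree p > degree q" and "coprime (degree p) (degree q)"
  shows "(\<alpha> \<in> subalgebra_spectrum (generated_subalgebra {p, q}) \<longleftrightarrow>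
           (poly (pderiv p) \<alpha> = 0 \<and> poly (pderiv q) \<alpha> = 0) \<or>
           (\<exists>\<beta>. \<beta> \<noteq> \<alpha> \<and> poly p \<alpha> = poly p \<beta> \<and> poly q \<alpha> = poly q \<beta>))
       \<and> ((poly (pderiv p) \<alpha> = 0 \<and> poly (pderiv q) \<alpha> = 0) \<or>
           (\<exists>\<beta>. \<beta> \<noteq> \<alpha> \<and> poly p \<alpha> = poly p \<beta> \<and> poly q \<alpha> = poly q \<beta>)
          \<longleftrightarrow> poly (characteristic_poly p q) \<alpha> = 0)"
proof
  show "\<alpha> \<in> subalgebra_spectrum (generated_subalgebra {p, q}) \<longleftrightarrow>
           (poly (pderiv p) \<alpha> = 0 \<and> poly (pderiv q) \<alpha> = 0) \<or>
           (\<exists>\<beta>. \<beta> \<noteq> \<alpha> \<and> poly p \<alpha> = poly p \<beta> \<and> poly q \<alpha> = poly q \<beta>)"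
    by (simp add: mem_subalgebra_spectrum_generated_iff)
next
  have "degree p > 0"
    using assms(3,4) by simp
  then have "poly (characteristic_poly p q) \<alpha> = 0 \<longleftrightarrow>
      (\<exists>\<beta>. poly (divided_difference_at \<alpha> p) \<beta> = 0 \<and> poly (divided_difference_at \<alpha> q) \<beta> = 0)"
    using assms(3)
    by (simp only: poly_characteristic_poly resultant_eq_0_iff_common_root
        degree_divided_difference_at(1) not_False_eq_True)
  then show "(poly (pderiv p) \<alpha> = 0 \<and> poly (pderiv q) \<alpha> = 0) \<or>
           (\<exists>\<beta>. \<beta> \<noteq> \<alpha> \<and> poly p \<alpha> = poly p \<beta> \<and> poly q \<alpha> = poly q \<beta>)
          \<longleftrightarrow> poly (characteristic_poly p q) \<alpha> = 0"
    unfolding poly_divided_difference_at_eq_0_iff by metis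
qed

end
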